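(* Let $k$ be a positive integer and let $r > 0$ be a real number. Let $G$ be a graph with a rational-valued length-function $\ell : E(G) \to \mathbb{R}_{>0}$ (that is, $\ell(e) \in \mathbb{Q}$ for every $e \in E(G)$). Suppose $G$ contains an $\ell$-geodesic cycle $C$ with $\ell(C) \geq 2rk$ which is the $\mathbb{F}_2$-sum of cycles of $G$ of $\ell$-length at most $r$. Then the tree-width of $G$ is at least $k$.
   Context: Graphs are finite, simple and undirected. A length-function on a graph $G$ is a map $\ell : E(G) \to \mathbb{R}_{>0}$. The $\ell$-length $\ell(H)$ of a subgraph $H \subseteq G$ is $\sum_{e \in E(H)} \ell(e)$. For vertices $a,b$ of $G$, the distance $d_G^{\ell}(a,b)$ is the minimum $\ell$-length of a path in $G$ containing both $a$ and $b$ (infinite if there is none). A subgraph $H \subseteq G$ is $\ell$-geodesic if for any two vertices $a,b \in V(H)$ it contains a path between $a$ and $b$ of $\ell$-length $d_G^{\ell}(a,b)$. A cycle $C$ is the $\mathbb{F}_2$-sum of a set $\mathcal{D}$ of cycles, written $C = \bigoplus \mathcal{D}$, if $E(C)$ is precisely the set of edges of $G$ that lie in an odd number of elements of $\mathcal{D}$. *)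

theory Defs
  imports Complex_Main "HOL-Library.Extended_Real"
begin

datatype 'v graph = Graph (verts: "'v set") (edges: "'v set set")

definition fin_simple_graph :: "'v graph \<Rightarrow> bool" where
  "fin_simple_graph G \<longleftrightarrow>
     finite (verts G) \<and> (\<forall>e\<in>edges G. e \<subseteq> verts G \<and> card e = 2)"

definition subgraph :: "'v graph \<Rightarrow> 'v graph \<Rightarrow> bool" where
  "subgraph H G \<longleftrightarrow>
     fin_simple_graph H \<and> verts H \<subseteq> verts G \<and> edges H \<subseteq> edges G"

text \<open>Paths and cycles are graphs, not vertex sequences. A single vertex is a (trivial) path.\<close>

definition path_graph :: "'v list \<Rightarrow> 'v graph" where
  "path_graph xs = Graph (set xs) {{xs ! i, xs ! Suc i} | i. Suc i < length xs}"

definition path_between :: "'v \<Rightarrow> 'v \<Rightarrow> 'v graph \<Rightarrow> bool" where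
  "path_between a b P \<longleftrightarrow>
     (\<exists>xs. xs \<noteq> [] \<and> distinct xs \<and> hd xs = a \<and> last xs = b \<and> P = path_graph xs)"

definition is_path :: "'v graph \<Rightarrow> bool" where
  "is_path P \<longleftrightarrow> (\<exists>a b. path_between a b P)"

definition is_cycle :: "'v graph \<Rightarrow> bool" where
  "is_cycle C \<longleftrightarrow>
     (\<exists>xs. 3 \<le> length xs \<and> distinct xs \<and>
        C = Graph (set xs) (insert {last xs, hd xs} (edges (path_graph xs))))"

text \<open>Only the values of a length-function on edges matter.\<close>

definition length_function :: "'v graph \<Rightarrow> ('v set \<Rightarrow> real) \<Rightarrow> bool" where
  "length_function G l \<longleftrightarrow> (\<forall>e\<in>edges G. 0 < l e)"

definition glength :: "('v set \<Rightarrow> real) \<Rightarrow> 'v graph \<Rightarrow> real" where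
  "glength l H = (\<Sum>e\<in>edges H. l e)"

text \<open>A finite graph has only finitely many paths, so the infimum is a minimum whenever some
  path contains both vertices, and it is \<open>\<infinity>\<close> otherwise.\<close>

definition gdist :: "'v graph \<Rightarrow> ('v set \<Rightarrow> real) \<Rightarrow> 'v \<Rightarrow> 'v \<Rightarrow> ereal" where
  "gdist G l a b =
     Inf {ereal (glength l P) | P. is_path P \<and> subgraph P G \<and> a \<in> verts P \<and> b \<in> verts P}"

definition geodesic :: "'v graph \<Rightarrow> ('v set \<Rightarrow> real) \<Rightarrow> 'v graph \<Rightarrow> bool" where
  "geodesic G l H \<longleftrightarrow> subgraph H G \<and>
     (\<forall>a\<in>verts H. \<forall>b\<in>verts H.
        \<exists>P. path_between a b P \<and> subgraph P H \<and> ereal (glength l P) = gdist G l a b)"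

definition is_F2_sum :: "'v graph \<Rightarrow> 'v graph \<Rightarrow> 'v graph set \<Rightarrow> bool" where
  "is_F2_sum G C D \<longleftrightarrow> edges C = {e \<in> edges G. odd (card {X \<in> D. e \<in> edges X})}"

definition connected_graph :: "'v graph \<Rightarrow> bool" where
  "connected_graph G \<longleftrightarrow> verts G \<noteq> {} \<and>
     (\<forall>a\<in>verts G. \<forall>b\<in>verts G. \<exists>P. path_between a b P \<and> subgraph P G)"

definition is_tree :: "'v graph \<Rightarrow> bool" where
  "is_tree T \<longleftrightarrow> fin_simple_graph T \<and> connected_graph T \<and> \<not> (\<exists>C. is_cycle C \<and> subgraph C T)"

definition tree_decomposition :: "'v graph \<Rightarrow> 't graph \<Rightarrow> ('t \<Rightarrow> 'v set) \<Rightarrow> bool" where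
  "tree_decomposition G T B \<longleftrightarrow> is_tree T \<and>
     verts G = (\<Union>t\<in>verts T. B t) \<and>
     (\<forall>e\<in>edges G. \<exists>t\<in>verts T. e \<subseteq> B t) \<and>
     (\<forall>s t P. path_between s t P \<and> subgraph P T \<longrightarrow> (\<forall>u\<in>verts P. B s \<inter> B t \<subseteq> B u))"

definition decomposition_width :: "'t graph \<Rightarrow> ('t \<Rightarrow> 'v set) \<Rightarrow> int" where
  "decomposition_width T B = int (Max ((\<lambda>t. card (B t)) ` verts T)) - 1"

text \<open>Every finite tree is isomorphic to one with nodes in \<open>nat\<close>, so fixing this node type is no
  restriction. The infimum is taken over a nonempty set of integers bounded below by \<open>-1\<close>, so
  it is attained.\<close>

definition tree_width :: "'v graph \<Rightarrow> int" where
  "tree_width G =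
     Inf {decomposition_width T B | (T :: nat graph) B. tree_decomposition G T B}"

end

(* Fix a tree-decomposition whose bags have at most k vertices. For a bag X, group its vertices
   into clusters such that every cycle of D meets at most one cluster and each cluster Y is joined
   up in G by edges of total length at most (|Y| - 1) r / 2. As C is geodesic, the vertices of C in
   one cluster are joined along C by edges of total length at most (|Y| - 1) r, so the union A of
   these edge sets has length less than half of that of C. A parity argument with the F2-sum shows
   that the remaining edges of C, more than half of C, either all meet or all avoid each union of
   components of G - X. Hence they all lie behind the same edge of the tree, and every node of the
   tree points to a neighbour. Two adjacent nodes point to each other; but their two sets of
   remaining edges intersect, and an edge in both would lie on both sides of the tree edge. *)

theory Submission imports Defs begin

section \<open>Walks, paths and crossing edges\<close>

text \<open>Connections are handled as edge sets \<open>E\<close> with the closure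
  \<open>(adj E)\<^sup>*\<close> instead of paths, so that such sets can be united and enlarged
  freely; a path is extracted only when needed.\<close>

definition adj :: "'v set set \<Rightarrow> ('v \<times> 'v) set" where
  "adj E = {(u, w). {u, w} \<in> E}"

text \<open>For a two-element \<open>e\<close> this means that \<open>e\<close> lies in the cut
  between \<open>S\<close> and its complement.\<close>

definition crosses :: "'v set \<Rightarrow> 'v set \<Rightarrow> bool" where
  "crosses e S \<longleftrightarrow> e \<inter> S \<noteq> {} \<and> \<not> e \<subseteq> S"

lemma adj_mono: "E \<subseteq> F \<Longrightarrow> adj E \<subseteq> adj F"
  by (auto simp: adj_def)

lemma rtrancl_adj_mono: "(a, b) \<in> (adj E)\<^sup>* \<Longrightarrow> E \<subseteq> F \<Longrightarrow> (a, b) \<in> (adj F)\<^sup>*"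
  using rtrancl_mono[OF adj_mono] by blast

lemma rtrancl_adj_sym: "(a, b) \<in> (adj E)\<^sup>* \<Longrightarrow> (b, a) \<in> (adj E)\<^sup>*"
proof -
  have "sym (adj E)" by (auto simp: sym_def adj_def insert_commute)
  then show "(a, b) \<in> (adj E)\<^sup>* \<Longrightarrow> (b, a) \<in> (adj E)\<^sup>*"
    by (metis sym_rtrancl symD)
qed

text \<open>A walk that starts in \<open>S\<close> and ends outside has to leave \<open>S\<close> at
  some step.\<close>

lemma rtrancl_adj_crosses:
  assumes "(a, b) \<in> (adj E)\<^sup>*" "a \<in> S" "b \<notin> S"
  shows "\<exists>e\<in>E. crosses e S"
  using assms
proof (induction rule: rtrancl_induct)
  case base then show ?case by simp
next
  case (step y z)
  show ?case
  proof (cases "y \<in> S")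
    case True
    then have "crosses {y, z} S" using step.prems by (auto simp: crosses_def)
    then show ?thesis using step.hyps by (auto simp: adj_def)
  next
    case False then show ?thesis using step by blast
  qed
qed

text \<open>Replaces the indices in \<open>path_graph\<close> by a predicate on consecutive entries,
  which suits induction on lists.\<close>

lemma edges_path_graph_subset:
  "edges (path_graph xs) \<subseteq> E \<longleftrightarrow> successively (\<lambda>u w. {u, w} \<in> E) xs"
  by (auto simp: path_graph_def successively_conv_nth)

lemma successively_rtrancl_adj:
  "successively (\<lambda>u w. {u, w} \<in> E) xs \<Longrightarrow> xs \<noteq> [] \<Longrightarrow> x \<in> set xs \<Longrightarrow> (hd xs, x) \<in> (adj E)\<^sup>*"
proof (induction xs)
  case Nil then show ?case by simp
next
  case (Cons a xs)
  show ?case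
  proof (cases "x = a \<or> xs = []")
    case True then show ?thesis using Cons.prems by auto
  next
    case False
    then have "(hd xs, x) \<in> (adj E)\<^sup>*" and "(a, hd xs) \<in> adj E"
      using Cons by (auto simp: successively_Cons adj_def)
    then show ?thesis by (simp add: converse_rtrancl_into_rtrancl)
  qed
qed

text \<open>The walk is shortened as it grows: if the new first vertex already occurs on the path,
  everything before that occurrence is dropped.\<close>

lemma rtrancl_adj_path:
  assumes "(a, b) \<in> (adj E)\<^sup>*"
  shows "\<exists>xs. xs \<noteq> [] \<and> distinct xs \<and> hd xs = a \<and> last xs = b \<and> edges (path_graph xs) \<subseteq> E"
  using assms
proof (induction rule: converse_rtrancl_induct)
  case base
  have "edges (path_graph [b]) \<subseteq> E" by (auto simp: path_graph_def)
  then show ?case by (intro exI[of _ "[b]"]) auto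
next
  case (step a y)
  then obtain xs where xs: "xs \<noteq> []" "distinct xs" "hd xs = y" "last xs = b"
    "successively (\<lambda>u w. {u, w} \<in> E) xs" by (auto simp: edges_path_graph_subset)
  have e: "{a, y} \<in> E" using step.hyps by (auto simp: adj_def)
  show ?case
  proof (cases "a \<in> set xs")
    case False
    then show ?thesis using xs e unfolding edges_path_graph_subset
      by (intro exI[of _ "a # xs"]) (auto simp: successively_Cons)
  next
    case True
    then obtain ys zs where "xs = ys @ a # zs" by (meson split_list)
    then show ?thesis using xs unfolding edges_path_graph_subset
      by (intro exI[of _ "a # zs"]) (auto simp: successively_append_iff)
  qed
qed

lemma fin_simple_path_graph: "distinct xs \<Longrightarrow> fin_simple_graph (path_graph xs)"
proof -
  assume d: "distinct xs"
  have "card {xs ! i, xs ! Suc i} = 2" if "Suc i < length xs" for i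
    using d that by (simp add: nth_eq_iff_index_eq)
  then show ?thesis
    unfolding fin_simple_graph_def path_graph_def by auto
qed

lemma finite_edges: "fin_simple_graph G \<Longrightarrow> finite (edges G)"
  by (rule finite_subset[of _ "Pow (verts G)"]) (auto simp: fin_simple_graph_def)

text \<open>All vertices are reached from the first one along edges of \<open>G\<close>. The first
  is required to lie in \<open>G\<close> because a one-vertex path has no edges.\<close>

lemma verts_path_graph_subset:
  assumes G: "fin_simple_graph G" and xs: "xs \<noteq> []" "hd xs \<in> verts G"
    and e: "edges (path_graph xs) \<subseteq> edges G"
  shows "set xs \<subseteq> verts G"
proof
  fix x assume "x \<in> set xs"
  then have "(hd xs, x) \<in> (adj (edges G))\<^sup>*"
    using successively_rtrancl_adj e xs by (simp add: edges_path_graph_subset)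
  then show "x \<in> verts G"
    by (induction rule: rtrancl_induct) (use G xs in \<open>auto simp: fin_simple_graph_def adj_def\<close>)
qed

lemma subgraph_path_graph:
  assumes "fin_simple_graph G" "xs \<noteq> []" "distinct xs" "hd xs \<in> verts G"
    and "edges (path_graph xs) \<subseteq> edges G"
  shows "subgraph (path_graph xs) G"
  using assms verts_path_graph_subset[OF assms(1,2,4,5)]
  by (simp add: subgraph_def fin_simple_path_graph) (simp add: path_graph_def)

lemma path_between_rtrancl_adj:
  assumes "path_between a b P" "x \<in> verts P" shows "(a, x) \<in> (adj (edges P))\<^sup>*"
proof -
  obtain xs where xs: "xs \<noteq> []" "hd xs = a" "P = path_graph xs"
    using assms by (auto simp: path_between_def)
  show ?thesis using successively_rtrancl_adj[of "edges P" xs x] xs assms(2)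
    by (auto simp: edges_path_graph_subset[symmetric]) (simp add: path_graph_def)
qed

text \<open>Some path inside \<open>E\<close> competes in the infimum, and by positivity of
  \<open>l\<close> it is no longer than all of \<open>E\<close>.\<close>

lemma gdist_le:
  assumes G: "fin_simple_graph G" "length_function G l" and E: "E \<subseteq> edges G"
    and a: "a \<in> verts G" and c: "(a, b) \<in> (adj E)\<^sup>*"
  shows "gdist G l a b \<le> ereal (sum l E)"
proof -
  obtain xs where xs: "xs \<noteq> []" "distinct xs" "hd xs = a" "last xs = b"
    "edges (path_graph xs) \<subseteq> E" using rtrancl_adj_path[OF c] by blast
  have "subgraph (path_graph xs) G" using subgraph_path_graph G(1) a xs E by blast
  moreover have "is_path (path_graph xs)" using xs by (auto simp: is_path_def path_between_def)
  moreover have "a \<in> verts (path_graph xs)" "b \<in> verts (path_graph xs)"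
    using xs by (auto simp: path_graph_def)
  ultimately have "gdist G l a b \<le> ereal (glength l (path_graph xs))"
    unfolding gdist_def by (intro Inf_lower) blast
  also have "\<dots> \<le> ereal (sum l E)"
    unfolding glength_def using xs(5) E G finite_subset[OF E finite_edges]
    by (auto intro!: sum_mono2 simp: length_function_def less_imp_le)
  finally show ?thesis .
qed

section \<open>Cycles\<close>

text \<open>A cycle is enumerated by an \<open>n\<close>-periodic sequence on all of \<open>nat\<close>, so that rotating it is
  a mere shift of the index.\<close>

definition cyclic_enum :: "'v graph \<Rightarrow> nat \<Rightarrow> (nat \<Rightarrow> 'v) \<Rightarrow> bool" where
  "cyclic_enum C n v \<longleftrightarrow> 3 \<le> n \<and> (\<forall>i j. v i = v j \<longleftrightarrow> i mod n = j mod n) \<and>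
     verts C = range v \<and> edges C = range (\<lambda>i. {v i, v (Suc i)})"

text \<open>Reading indices modulo \<open>n\<close> turns the closing edge from
  \<open>last xs\<close> to \<open>hd xs\<close> into the ordinary edge with index
  \<open>n - 1\<close>.\<close>

lemma is_cycle_enum:
  assumes "is_cycle C" obtains n v where "cyclic_enum C n v"
proof -
  obtain xs where xs: "3 \<le> length xs" "distinct xs"
    and C: "C = Graph (set xs) (insert {last xs, hd xs} (edges (path_graph xs)))"
    using assms by (auto simp: is_cycle_def)
  define n where "n = length xs"
  define v where "v i = xs ! (i mod n)" for i
  have n: "3 \<le> n" using xs n_def by simp
  have lt: "i mod n < n" for i using n by simp
  have inj: "v i = v j \<longleftrightarrow> i mod n = j mod n" for i j
    using xs lt by (simp add: v_def n_def nth_eq_iff_index_eq)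
  have "xs \<noteq> []" using n by (auto simp: n_def)
  then have last: "last xs = xs ! (n - 1)" and hd: "hd xs = xs ! 0"
    by (simp_all add: last_conv_nth hd_conv_nth n_def)
  have "set xs = range v"
  proof
    show "set xs \<subseteq> range v"
    proof
      fix x assume "x \<in> set xs"
      then obtain i where "i < n" "x = xs ! i" by (auto simp: in_set_conv_nth n_def)
      then have "x = v i" by (simp add: v_def)
      then show "x \<in> range v" by blast
    qed
    show "range v \<subseteq> set xs" using lt by (auto simp: v_def n_def)
  qed
  moreover have "insert {last xs, hd xs} (edges (path_graph xs)) = range (\<lambda>i. {v i, v (Suc i)})"
    (is "?L = ?R")
  proof
    have l: "last xs = v (n - 1)" using n last by (simp add: v_def)
    have h: "hd xs = v (Suc (n - 1))" using n hd by (simp add: v_def)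
    have "{last xs, hd xs} \<in> ?R"
      by (rule image_eqI[where x = "n - 1"]) (simp_all only: l h UNIV_I)
    moreover have "{xs ! i, xs ! Suc i} \<in> ?R" if "Suc i < n" for i
      using that by (intro image_eqI[of _ _ i]) (auto simp: v_def)
    ultimately show "?L \<subseteq> ?R" by (auto simp: path_graph_def n_def)
    show "?R \<subseteq> ?L"
    proof
      fix e assume "e \<in> ?R"
      then obtain i where e: "e = {v i, v (Suc i)}" by blast
      show "e \<in> ?L"
      proof (cases "Suc (i mod n) = n")
        case True
        then have "i mod n = n - 1" "Suc i mod n = 0" by (simp_all add: mod_Suc)
        then have "v i = last xs" "v (Suc i) = hd xs" using last hd by (simp_all add: v_def)
        then show ?thesis using e by simp
      next
        case False
        then have "Suc (i mod n) < n" "v (Suc i) = xs ! Suc (i mod n)"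
          using lt[of i] by (auto simp: v_def mod_Suc)
        then show ?thesis using e by (auto simp: v_def path_graph_def n_def)
      qed
    qed
  qed
  ultimately have "cyclic_enum C n v" using n inj C by (simp add: cyclic_enum_def)
  then show ?thesis using that by blast
qed

lemma cyclic_enum_shift:
  assumes "cyclic_enum C n v" shows "cyclic_enum C n (\<lambda>i. v (i + s))"
proof -
  have v: "v i = v j \<longleftrightarrow> i mod n = j mod n" for i j using assms by (simp add: cyclic_enum_def)
  have n: "n \<ge> 3" using assms by (simp add: cyclic_enum_def)
  \<comment> \<open>The old index \<open>i\<close> turns up in the shifted sequence at
    \<open>i + s * (n - 1)\<close>, after \<open>s\<close> full rounds.\<close>
  have j: "i + s * (n - 1) + s = i + s * n" for i
    using n by (cases n) auto
  have "v i = v (i + s * (n - 1) + s)" "v (Suc i) = v (Suc (i + s * (n - 1)) + s)" for i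
    unfolding j add_Suc[symmetric] by (simp_all only: v mod_mult_self1)
  then have "range v = range (\<lambda>i. v (i + s))"
    "range (\<lambda>i. {v i, v (Suc i)}) = range (\<lambda>i. {v (i + s), v (Suc i + s)})"
    by (auto simp: image_iff) metis+
  moreover have "(i + s) mod n = (m + s) mod n \<longleftrightarrow> i mod n = m mod n" for i m
  proof
    assume "(i + s) mod n = (m + s) mod n"
    then have "(i + s + s * (n - 1)) mod n = (m + s + s * (n - 1)) mod n"
      by (rule mod_add_cong) simp
    moreover have "i + s + s * (n - 1) = i + s * n" for i using j[of i] by simp
    ultimately show "i mod n = m mod n" by (simp only: mod_mult_self1)
  qed (rule mod_add_cong, auto)
  ultimately show ?thesis using assms by (simp add: cyclic_enum_def)
qed

lemma cyclic_enum_from: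
  assumes "cyclic_enum C n v" "a \<in> verts C"
  obtains w where "cyclic_enum C n w" "w 0 = a"
proof -
  obtain s where "a = v s" using assms by (auto simp: cyclic_enum_def)
  then show ?thesis using that cyclic_enum_shift[OF assms(1), of s] by simp
qed

locale cycle_enum =
  fixes C :: "'v graph" and n :: nat and v :: "nat \<Rightarrow> 'v"
  assumes cyclic: "cyclic_enum C n v"
begin

abbreviation edge :: "nat \<Rightarrow> 'v set" where "edge i \<equiv> {v i, v (Suc i)}"

lemma n_ge: "n \<ge> 3" and v_eq: "v i = v j \<longleftrightarrow> i mod n = j mod n"
  and verts_range: "verts C = range v" and edges_range: "edges C = range edge"
  using cyclic by (simp_all add: cyclic_enum_def)

text \<open>Equal edges with different indices would be traversed in opposite directions, which
  forces \<open>n dvd 2\<close>, while \<open>n\<close> is at least 3.\<close>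

lemma edge_eq: "edge i = edge j \<longleftrightarrow> i mod n = j mod n"
proof
  assume "i mod n = j mod n"
  then show "edge i = edge j" by (metis v_eq mod_Suc)
next
  assume e: "edge i = edge j"
  show "i mod n = j mod n"
  proof (rule ccontr)
    assume "i mod n \<noteq> j mod n"
    then have "Suc i mod n = j mod n" "i mod n = Suc j mod n"
      using e by (auto simp: doubleton_eq_iff v_eq)
    then have "(j + 2) mod n = j mod n" by (metis add_2_eq_Suc' mod_Suc_eq)
    then have "n dvd 2" by (metis add_diff_cancel_left' le_add1 mod_eq_dvd_iff_nat)
    then show False using n_ge by (auto dest: dvd_imp_le)
  qed
qed

lemma edge_inj: "inj_on edge {..<n}"
  using edge_eq by (auto intro!: inj_onI) 

lemma edges_image: "edges C = edge ` {..<n}"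
proof -
  have "edge i = edge (i mod n)" for i using edge_eq by simp
  moreover have "i mod n < n" for i using n_ge by simp
  ultimately show ?thesis unfolding edges_range by blast
qed

lemma verts_image: "verts C = v ` {..<n}"
proof -
  have "v i = v (i mod n)" for i using v_eq by simp
  moreover have "i mod n < n" for i using n_ge by simp
  ultimately show ?thesis unfolding verts_range by blast
qed

lemma card_edge: "card (edge i) = 2"
proof -
  have "v i \<noteq> v (Suc i)" using n_ge by (auto simp: v_eq mod_Suc)
  then show ?thesis by simp
qed

text \<open>The bound \<open>m \<le> n\<close> includes the far end of the last edge:
  \<open>v n = v 0\<close> lies outside the arc.\<close>

lemma arc_mem: "m \<le> n \<Longrightarrow> j < n \<Longrightarrow> v m \<in> v ` {i<..j} \<longleftrightarrow> m \<in> {i<..j}"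
  by (cases "m = n") (auto simp: v_eq image_iff)

text \<open>Edge \<open>i\<close> enters the arc of the vertices with indices from
  \<open>i + 1\<close> to \<open>j\<close>, and edge \<open>j\<close> leaves it; every other edge
  has both ends inside or both outside.\<close>

lemma crosses_arc:
  assumes "i < j" "j < n" "m < n"
  shows "crosses (edge m) (v ` {i<..j}) \<longleftrightarrow> m = i \<or> m = j"
  using assms arc_mem[of m j i] arc_mem[of "Suc m" j i] unfolding crosses_def by auto

lemma rtrancl_arc:
  assumes "i \<le> j" "\<And>m. i \<le> m \<Longrightarrow> m < j \<Longrightarrow> edge m \<in> E" shows "(v i, v j) \<in> (adj E)\<^sup>*"
  using assms
proof (induction j rule: dec_induct)
  case base then show ?case by simp
next
  case (step j)
  then have "(v i, v j) \<in> (adj E)\<^sup>*" "(v j, v (Suc j)) \<in> adj E" by (auto simp: adj_def)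
  then show ?case by (simp add: rtrancl.rtrancl_into_rtrancl)
qed

lemma sum_edges: "sum l (edge ` I) = (\<Sum>i\<in>I. l (edge i))" if "I \<subseteq> {..<n}"
  using sum.reindex[OF inj_on_subset[OF edge_inj that], of l] by simp

lemma glength_eq: "glength l C = (\<Sum>i<n. l (edge i))"
  by (simp add: glength_def edges_image sum_edges)

end

section \<open>Double counting: parity of degrees, cuts and sums of cycles\<close>

lemma sum_card_swap:
  assumes "finite A" "finite B"
  shows "(\<Sum>a\<in>A. card {b\<in>B. R a b}) = (\<Sum>b\<in>B. card {a\<in>A. R a b})"
proof -
  have "(\<Sum>a\<in>A. card {b\<in>B. R a b}) = (\<Sum>a\<in>A. \<Sum>b\<in>B. if R a b then 1 else 0)"
    using assms by (simp add: sum.If_cases Int_def)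
  also have "\<dots> = (\<Sum>b\<in>B. \<Sum>a\<in>A. if R a b then 1 else 0)" by (rule sum.swap)
  also have "\<dots> = (\<Sum>b\<in>B. card {a\<in>A. R a b})"
    using assms by (simp add: sum.If_cases Int_def)
  finally show ?thesis .
qed

text \<open>In the degree sum an edge inside \<open>S\<close> counts twice, an edge crossing
  \<open>S\<close> once, and any other edge not at all.\<close>

lemma even_degree_sum_iff:
  assumes "finite E" "\<And>g. g \<in> E \<Longrightarrow> card g = 2" "finite S"
  shows "even (\<Sum>x\<in>S. card {g\<in>E. x \<in> g}) \<longleftrightarrow> even (card {g\<in>E. crosses g S})"
proof -
  have "odd (card {x\<in>S. x \<in> g}) \<longleftrightarrow> crosses g S" if gE: "g \<in> E" for g
  proof -
    obtain a b where g: "g = {a, b}" "a \<noteq> b" using assms(2)[OF gE] by (auto simp: card_2_iff)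
    have "{x\<in>S. x \<in> g} = (if a \<in> S then {a} else {}) \<union> (if b \<in> S then {b} else {})"
      using g by auto
    then show ?thesis using g by (auto simp: crosses_def)
  qed
  then have "{g\<in>E. odd (card {x\<in>S. x \<in> g})} = {g\<in>E. crosses g S}" by blast
  then show ?thesis unfolding sum_card_swap[OF assms(3,1)] even_sum_iff[OF assms(1)] by simp
qed

text \<open>The pairs of a cycle in \<open>D\<close> and an edge of \<open>F\<close> on it are
  counted in two ways; the edges of \<open>F\<close> with odd multiplicity are those on
  \<open>C\<close>.\<close>

lemma even_inter_F2_sum:
  assumes "finite D" "finite F" "F \<subseteq> edges G" "is_F2_sum G C D"
    and "\<And>X. X \<in> D \<Longrightarrow> even (card (edges X \<inter> F))"
  shows "even (card (edges C \<inter> F))"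
proof -
  have "even (\<Sum>e\<in>F. card {X\<in>D. e \<in> edges X})"
    using assms sum_card_swap[OF assms(2,1), of "\<lambda>e X. e \<in> edges X"]
    by (auto intro!: dvd_sum simp: Int_def conj_commute)
  moreover have "{e\<in>F. odd (card {X\<in>D. e \<in> edges X})} = edges C \<inter> F"
    using assms(3,4) by (auto simp: is_F2_sum_def)
  ultimately show ?thesis unfolding even_sum_iff[OF assms(2)] by simp
qed

lemma is_cycle_simple:
  assumes "is_cycle C"
  shows "finite (edges C)" "\<And>g. g \<in> edges C \<Longrightarrow> card g = 2 \<and> g \<subseteq> verts C"
proof -
  obtain n v where "cyclic_enum C n v" using is_cycle_enum assms by blast
  then interpret cycle_enum C n v by unfold_locales
  show "finite (edges C)" by (simp add: edges_image)
  show "card g = 2 \<and> g \<subseteq> verts C" if "g \<in> edges C" for g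
    using that card_edge by (auto simp: edges_range verts_range)
qed

lemma even_degree:
  assumes "is_cycle C" shows "even (card {g\<in>edges C. x \<in> g})"
proof (cases "x \<in> verts C")
  case False
  then have "{g\<in>edges C. x \<in> g} = {}" using is_cycle_simple[OF assms] by blast
  then show ?thesis by (metis card.empty even_zero)
next
  case True
  obtain n u where u: "cyclic_enum C n u" using is_cycle_enum assms by blast
  obtain s where s: "x = u s" using True u by (auto simp: cyclic_enum_def)
  \<comment> \<open>The shift puts \<open>x\<close> at index 1, so that its two edges are numbers 0
    and 1 without wrapping around; the summand \<open>n\<close> keeps the subtraction exact for
    \<open>s = 0\<close>.\<close>
  define v where "v i = u (i + (s + n - 1))" for i
  have "cyclic_enum C n v" unfolding v_def by (rule cyclic_enum_shift[OF u])
  then interpret cycle_enum C n v by unfold_locales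
  have "1 + (s + n - 1) = s + n" using n_ge by simp
  then have x: "x = v 1" using u s unfolding v_def cyclic_enum_def by (metis mod_add_self2)
  have "v 1 \<in> edge i \<longleftrightarrow> i = 0 \<or> i = 1" if "i < n" for i
    using that n_ge by (auto simp: v_eq mod_Suc)
  then have "{g\<in>edges C. x \<in> g} = {edge 0, edge 1}"
    using n_ge unfolding edges_image x by auto
  moreover have "edge 0 \<noteq> edge 1" using n_ge edge_eq[of 0 1] by simp
  ultimately show ?thesis by (metis card_2_iff even_numeral)
qed

text \<open>The two arcs between \<open>x\<close> and \<open>y\<close> have lengths adding up to
  that of the cycle; the shorter one is taken.\<close>

lemma cycle_half:
  assumes "is_cycle C" "x \<in> verts C" "y \<in> verts C"
  obtains E where "E \<subseteq> edges C" "sum l E \<le> glength l C / 2" "(x, y) \<in> (adj E)\<^sup>*"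
proof -
  obtain n u where "cyclic_enum C n u" using is_cycle_enum assms by blast
  then obtain v where "cyclic_enum C n v" and v0: "v 0 = x" using cyclic_enum_from assms(2) by metis
  then interpret cycle_enum C n v by unfold_locales
  obtain i where i: "i < n" "y = v i" using assms(3) verts_image by auto
  have split: "{..<n} = {..<i} \<union> {i..<n}" using i by auto
  have "glength l C = sum l (edge ` {..<i}) + sum l (edge ` {i..<n})"
    using i unfolding glength_eq split
    by (subst (1 2) sum_edges) (auto intro!: sum.union_disjoint)
  moreover have "edge ` {..<i} \<subseteq> edges C" "edge ` {i..<n} \<subseteq> edges C" by (auto simp: edges_range)
  moreover have "(x, y) \<in> (adj (edge ` {..<i}))\<^sup>*"
    using rtrancl_arc[of 0 i] v0 i by auto
  moreover have "(y, v n) \<in> (adj (edge ` {i..<n}))\<^sup>*" "v n = x"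
    using rtrancl_arc[of i n] v0 i by (auto simp: v_eq simp flip: v0)
  then have "(x, y) \<in> (adj (edge ` {i..<n}))\<^sup>*" using rtrancl_adj_sym by metis
  ultimately show ?thesis
    using that[of "edge ` {..<i}"] that[of "edge ` {i..<n}"] by linarith
qed

text \<open>Deleting \<open>e\<close> and \<open>f\<close> leaves two paths of the cycle;
  \<open>S\<close> is the vertex set of one of them.\<close>

lemma cycle_separating_arc:
  assumes "is_cycle C" "e \<in> edges C" "f \<in> edges C" "e \<noteq> f"
  obtains S where "S \<subseteq> verts C" "{g\<in>edges C. crosses g S} = {e, f}"
proof -
  obtain n v where "cyclic_enum C n v" using is_cycle_enum assms by blast
  then interpret cycle_enum C n v by unfold_locales
  obtain i j where ij: "i < n" "j < n" "{e, f} = {edge i, edge j}" "i < j"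
  proof -
    obtain i j where ij: "i < n" "j < n" "e = edge i" "f = edge j"
      using assms edges_image by auto
    then have "i \<noteq> j" using assms by auto
    then show ?thesis using that[of i j] that[of j i] ij by fastforce
  qed
  show ?thesis
  proof
    show "v ` {i<..j} \<subseteq> verts C" by (auto simp: verts_range)
    show "{g\<in>edges C. crosses g (v ` {i<..j})} = {e, f}"
      using crosses_arc[of i j] ij unfolding edges_image ij(3) by auto
  qed
qed

text \<open>\<open>A\<close> consists of the edges within length \<open>\<delta>\<close> of
  \<open>a\<close> along \<open>C\<close>, in either direction. For \<open>y\<close> within distance
  \<open>\<delta>\<close> in \<open>G\<close>, geodesicity gives a path in \<open>C\<close> of
  length at most \<open>\<delta>\<close>; it contains a whole arc between \<open>a\<close> and
  \<open>y\<close>, and this arc lies in \<open>A\<close>. Thus one set \<open>A\<close> serves all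
  such \<open>y\<close> at once.\<close>

lemma geodesic_cycle_near:
  assumes G: "fin_simple_graph G" "length_function G l"
    and C: "is_cycle C" "geodesic G l C" and a: "a \<in> verts C" and \<delta>: "0 \<le> \<delta>"
  obtains A where "A \<subseteq> edges C" "sum l A \<le> 2 * \<delta>"
    "\<And>y. y \<in> verts C \<Longrightarrow> gdist G l a y \<le> ereal \<delta> \<Longrightarrow> (a, y) \<in> (adj A)\<^sup>*"
proof -
  obtain n u where "cyclic_enum C n u" using is_cycle_enum C by blast
  then obtain v where "cyclic_enum C n v" and v0: "v 0 = a" using cyclic_enum_from a by metis
  then interpret cycle_enum C n v by unfold_locales
  have "edge i \<in> edges C" for i by (simp add: edges_range)
  moreover have "edges C \<subseteq> edges G" using C(2) by (simp add: geodesic_def subgraph_def)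
  ultimately have pos: "0 \<le> l (edge i)" for i
    using G(2) by (meson length_function_def less_imp_le subsetD)
  \<comment> \<open>\<open>p\<close> measures the length along \<open>C\<close> from
    \<open>a\<close>. The edges in \<open>I1\<close> end within \<open>\<delta>\<close> of the start
    of the round, those in \<open>I2\<close> begin within \<open>\<delta>\<close> of its
    end.\<close>
  define p where "p i = (\<Sum>j<i. l (edge j))" for i
  define I1 where "I1 = {j. j < n \<and> p (Suc j) \<le> \<delta>}"
  define I2 where "I2 = {j. j < n \<and> p n - \<delta> \<le> p j}"
  have fin: "finite I1" "finite I2" unfolding I1_def I2_def by auto
  have p_mono: "p i \<le> p j" if "i \<le> j" for i j
    unfolding p_def using that pos by (intro sum_mono2) auto
  have p_tail: "(\<Sum>j=i..<n. l (edge j)) = p n - p i" if "i \<le> n" for i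
    using sum.atLeastLessThan_concat[OF le0 that, of "\<lambda>j. l (edge j)"]
    by (simp add: p_def lessThan_atLeast0)
  have s1: "sum l (edge ` I1) \<le> \<delta>"
  proof (cases "I1 = {}")
    case True then show ?thesis using \<delta> by simp
  next
    case False
    have "sum l (edge ` I1) = (\<Sum>i\<in>I1. l (edge i))" by (rule sum_edges) (auto simp: I1_def)
    also have "\<dots> \<le> p (Suc (Max I1))"
      unfolding p_def using pos fin by (intro sum_mono2) (auto simp: less_Suc_eq_le)
    also have "\<dots> \<le> \<delta>" using Max_in[OF fin(1) False] by (simp add: I1_def)
    finally show ?thesis .
  qed
  have s2: "sum l (edge ` I2) \<le> \<delta>"
  proof (cases "I2 = {}")
    case True then show ?thesis using \<delta> by simp
  next
    case False
    have m: "Min I2 < n" "p n - \<delta> \<le> p (Min I2)" using Min_in[OF fin(2) False] by (simp_all add: I2_def)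
    have "sum l (edge ` I2) = (\<Sum>i\<in>I2. l (edge i))" by (rule sum_edges) (auto simp: I2_def)
    also have "\<dots> \<le> (\<Sum>i=Min I2..<n. l (edge i))"
      using pos fin by (intro sum_mono2) (auto simp: I2_def)
    also have "\<dots> \<le> \<delta>" using p_tail[of "Min I2"] m by simp
    finally show ?thesis .
  qed
  have "sum l (edge ` (I1 \<union> I2)) \<le> sum l (edge ` I1) + sum l (edge ` I2)"
    unfolding image_Un using fin pos by (subst sum_Un) (auto intro!: sum_nonneg)
  then have s: "sum l (edge ` (I1 \<union> I2)) \<le> 2 * \<delta>" using s1 s2 by simp
  have near: "(a, y) \<in> (adj (edge ` (I1 \<union> I2)))\<^sup>*"
    if y: "y \<in> verts C" "gdist G l a y \<le> ereal \<delta>" for y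
  proof -
    obtain i where i: "i < n" "y = v i" using y verts_image by auto
    obtain P where P: "path_between a y P" "subgraph P C" "ereal (glength l P) = gdist G l a y"
      using C(2) a y unfolding geodesic_def by blast
    have lP: "glength l P \<le> \<delta>" using P(3) y(2) by (metis ereal_less_eq(3))
    have eP: "edges P \<subseteq> edges C" "finite (edges P)"
      using P(2) is_cycle_simple(1)[OF C(1)] finite_subset by (auto simp: subgraph_def)
    have le: "sum l (edge ` I) \<le> \<delta>" if "edge ` I \<subseteq> edges P" for I
    proof -
      have "sum l (edge ` I) \<le> glength l P" unfolding glength_def
        using that eP pos by (intro sum_mono2) (auto simp: edges_range)
      then show ?thesis using lP by simp
    qed
    have "y \<in> verts P" using P(1) by (auto simp: path_between_def path_graph_def)
    then have conn: "(v 0, v i) \<in> (adj (edges P))\<^sup>*"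
      using path_between_rtrancl_adj[OF P(1)] i v0 by simp
    \<comment> \<open>If \<open>P\<close> missed an edge \<open>k\<close> on one arc and an edge
      \<open>m\<close> on the other, the vertices between them, \<open>v i\<close> included but not
      \<open>v 0\<close>, could be reached only through one of these two edges.\<close>
    consider "\<And>k. k < i \<Longrightarrow> edge k \<in> edges P" | "\<And>k. i \<le> k \<Longrightarrow> k < n \<Longrightarrow> edge k \<in> edges P"
    proof -
      have False if k: "k < i" "edge k \<notin> edges P" "i \<le> m" "m < n" "edge m \<notin> edges P" for k m
      proof -
        have "v i \<in> v ` {k<..m}" "v 0 \<notin> v ` {k<..m}"
          using arc_mem[of i m k] arc_mem[of 0 m k] k i by auto
        then obtain g where g: "g \<in> edges P" "crosses g (v ` {k<..m})"
          using rtrancl_adj_crosses[OF rtrancl_adj_sym[OF conn]] by blast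
        then obtain q where "q < n" "g = edge q" using eP edges_image by blast
        then show False using g k crosses_arc[of k m q] by auto
      qed
      then show ?thesis using that by blast
    qed
    then show ?thesis
    proof cases
      case 1
      then have "sum l (edge ` {..<i}) \<le> \<delta>" by (intro le) auto
      then have "p i \<le> \<delta>" using i by (subst (asm) sum_edges) (auto simp: p_def)
      then have "k \<in> I1" if "k < i" for k
        using p_mono[of "Suc k" i] that i by (simp add: I1_def)
      then have "(v 0, v i) \<in> (adj (edge ` (I1 \<union> I2)))\<^sup>*" by (intro rtrancl_arc) auto
      then show ?thesis using v0 i by simp
    next
      case 2
      then have "sum l (edge ` {i..<n}) \<le> \<delta>" by (intro le) auto
      then have "p n - p i \<le> \<delta>" using i p_tail[of i] by (subst (asm) sum_edges) auto
      then have "k \<in> I2" if "i \<le> k" "k < n" for k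
        using p_mono[of i k] that i by (simp add: I2_def)
      then have "(v i, v n) \<in> (adj (edge ` (I1 \<union> I2)))\<^sup>*" using i by (intro rtrancl_arc) auto
      moreover have "v n = v 0" by (simp add: v_eq)
      ultimately show ?thesis using v0 i rtrancl_adj_sym by metis
    qed
  qed
  show ?thesis by (rule that[OF _ s near]) (auto simp: edges_range)
qed

section \<open>Separators and the \<open>\<F>\<^sub>2\<close>-sum\<close>

locale geodesic_cycle_sum =
  fixes G C :: "'v graph" and l :: "'v set \<Rightarrow> real" and r :: real and D :: "'v graph set"
  assumes G: "fin_simple_graph G" "length_function G l"
    and C: "is_cycle C" "geodesic G l C"
    and D: "\<And>X. X \<in> D \<Longrightarrow> is_cycle X \<and> subgraph X G \<and> glength l X \<le> r"
    and sum: "is_F2_sum G C D"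
    and r: "0 \<le> r"
begin

lemma C_sub: "edges C \<subseteq> edges G" "verts C \<subseteq> verts G"
  using C(2) by (simp_all add: geodesic_def subgraph_def)

text \<open>Double counting over \<open>D\<close> needs finiteness; a member of \<open>D\<close> is
  determined by a subset of \<open>verts G\<close> and one of \<open>edges G\<close>.\<close>

lemma finite_D: "finite D"
proof -
  have "finite (case_prod Graph ` (Pow (verts G) \<times> Pow (edges G)))"
    using finite_edges[OF G(1)] G(1) by (simp add: fin_simple_graph_def)
  moreover have "X \<in> case_prod Graph ` (Pow (verts G) \<times> Pow (edges G))" if "X \<in> D" for X
    using D[OF that] by (cases X) (auto simp: subgraph_def)
  ultimately show ?thesis by (meson finite_subset subsetI)
qed

lemma l_nonneg: "e \<in> edges G \<Longrightarrow> 0 \<le> l e"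
  using G(2) by (simp add: length_function_def less_imp_le)

lemma sum_l_nonneg: "E \<subseteq> edges G \<Longrightarrow> 0 \<le> sum l E"
  using l_nonneg by (intro sum_nonneg) auto

lemma sum_l_Un: "E \<subseteq> edges G \<Longrightarrow> F \<subseteq> edges G \<Longrightarrow> sum l (E \<union> F) \<le> sum l E + sum l F"
  using finite_edges[OF G(1)] sum_l_nonneg[of "E \<inter> F"]
  by (subst sum_Un) (auto intro: finite_subset)

text \<open>An odd count is not zero, so \<open>e\<close> lies on some cycle in \<open>D\<close>,
  which has length at most \<open>r\<close>.\<close>

lemma edge_le:
  assumes "e \<in> edges C" shows "l e \<le> r"
proof -
  have "{X\<in>D. e \<in> edges X} \<noteq> {}"
    using assms sum by (auto simp: is_F2_sum_def simp del: Collect_empty_eq)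
  then obtain X where X: "X \<in> D" "e \<in> edges X" by blast
  then have "edges X \<subseteq> edges G" using D by (simp add: subgraph_def)
  then have "sum l {e} \<le> glength l X"
    unfolding glength_def using X is_cycle_simple(1) D l_nonneg by (intro sum_mono2) auto
  then show ?thesis using D[OF X(1)] by simp
qed

text \<open>\<open>Y\<close> is maximal among the sets containing \<open>x\<close> that can be
  joined up at the stated cost. If a cycle in \<open>D\<close> met \<open>Y\<close> and also
  contained a vertex \<open>z\<close> of \<open>X - Y\<close>, then at most half of that cycle would
  join \<open>z\<close> to \<open>Y\<close> at an extra cost of at most \<open>r / 2\<close>,
  against maximality.\<close>

lemma cluster:
  assumes "finite X" "X \<subseteq> verts G" "x \<in> X"
  obtains Y E where "x \<in> Y" "Y \<subseteq> X" "E \<subseteq> edges G" "sum l E \<le> real (card Y - 1) * (r / 2)"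
    "\<And>y. y \<in> Y \<Longrightarrow> (x, y) \<in> (adj E)\<^sup>*"
    "\<And>Q. Q \<in> D \<Longrightarrow> verts Q \<inter> Y \<noteq> {} \<Longrightarrow> verts Q \<inter> X \<subseteq> Y"
proof -
  define good where "good Y \<longleftrightarrow> x \<in> Y \<and> Y \<subseteq> X \<and> (\<exists>E\<subseteq>edges G. sum l E \<le> real (card Y - 1) * (r / 2) \<and>
     (\<forall>y\<in>Y. (x, y) \<in> (adj E)\<^sup>*))" for Y
  have "good {x}" unfolding good_def using assms by (auto intro!: exI[of _ "{}"])
  moreover have "finite {Y. good Y}"
    using assms(1) by (rule_tac finite_subset[of _ "Pow X"]) (auto simp: good_def)
  ultimately obtain Y where Y: "good Y" and max: "\<And>Z. good Z \<Longrightarrow> Y \<subseteq> Z \<Longrightarrow> Y = Z"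
    using finite_has_maximal[of "{Y. good Y}"] by blast
  then obtain E where E: "E \<subseteq> edges G" "sum l E \<le> real (card Y - 1) * (r / 2)"
    "\<And>y. y \<in> Y \<Longrightarrow> (x, y) \<in> (adj E)\<^sup>*" unfolding good_def by blast
  have xY: "x \<in> Y" "Y \<subseteq> X" "finite Y" using Y assms(1) finite_subset by (auto simp: good_def)
  have "verts Q \<inter> X \<subseteq> Y" if Q: "Q \<in> D" "verts Q \<inter> Y \<noteq> {}" for Q
  proof
    fix z assume z: "z \<in> verts Q \<inter> X"
    obtain y where y: "y \<in> verts Q" "y \<in> Y" using Q by blast
    obtain F where F: "F \<subseteq> edges Q" "sum l F \<le> glength l Q / 2" "(y, z) \<in> (adj F)\<^sup>*"
      using cycle_half[of Q y z l] D[OF Q(1)] y z by blast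
    have FG: "F \<subseteq> edges G" using F D[OF Q(1)] by (auto simp: subgraph_def)
    show "z \<in> Y"
    proof (rule ccontr)
      assume zY: "z \<notin> Y"
      \<comment> \<open>Subtraction is truncated; since \<open>Y\<close> is nonempty, adding
        \<open>z\<close> raises \<open>card Y - 1\<close> by exactly 1.\<close>
      have "card Y > 0" using xY(1,3) card_gt_0_iff[of Y] by auto
      then obtain m where "card Y = Suc m" using gr0_implies_Suc by blast
      then have card: "real (card (insert z Y) - 1) = real (card Y - 1) + 1" using zY xY by simp
      have "sum l (E \<union> F) \<le> real (card Y - 1) * (r / 2) + r / 2"
        using sum_l_Un[OF E(1) FG] E(2) F(2) D[OF Q(1)] by linarith
      also have "\<dots> = real (card (insert z Y) - 1) * (r / 2)" unfolding card by (simp add: algebra_simps)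
      finally have "sum l (E \<union> F) \<le> real (card (insert z Y) - 1) * (r / 2)" .
      moreover have "(x, w) \<in> (adj (E \<union> F))\<^sup>*" if "w \<in> Y" for w
        using E(3)[OF that] rtrancl_adj_mono by (metis Un_upper1)
      moreover have "(x, z) \<in> (adj (E \<union> F))\<^sup>*"
        using E(3)[OF y(2)] F(3) rtrancl_adj_mono by (metis Un_upper1 Un_upper2 rtrancl_trans)
      ultimately have "good (insert z Y)"
        unfolding good_def using xY z E(1) FG by (auto intro!: exI[of _ "E \<union> F"])
      then show False using max zY by blast
    qed
  qed
  then show ?thesis using that[OF xY(1,2) E] by blast
qed

text \<open>If \<open>A\<close> joins, within \<open>C\<close>, all vertices on \<open>C\<close> of each cluster of \<open>X\<close>, then a set \<open>S\<close> crossed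
  by no edge of \<open>A\<close> induces a union \<open>Z\<close> of clusters; no cycle of \<open>D\<close> meets two clusters.\<close>

definition cluster_edges :: "'v set \<Rightarrow> 'v set set \<Rightarrow> bool" where
  "cluster_edges X A \<longleftrightarrow> A \<subseteq> edges C \<and> sum l A \<le> real (card X - 1) * r \<and>
    (\<forall>S. (\<forall>e\<in>A. \<not> crosses e S) \<longrightarrow> (\<exists>Z\<subseteq>X. Z \<inter> verts C = X \<inter> S \<inter> verts C \<and>
       (\<forall>Q\<in>D. verts Q \<inter> X \<subseteq> Z \<or> verts Q \<inter> Z = {})))"

lemma cluster_edgesD:
  assumes "cluster_edges X A" "\<forall>e\<in>A. \<not> crosses e S"
  obtains Z where "Z \<subseteq> X" "Z \<inter> verts C = X \<inter> S \<inter> verts C"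
    "\<And>Q. Q \<in> D \<Longrightarrow> verts Q \<inter> X \<subseteq> Z \<or> verts Q \<inter> Z = {}"
proof -
  have "\<exists>Z\<subseteq>X. Z \<inter> verts C = X \<inter> S \<inter> verts C \<and>
       (\<forall>Q\<in>D. verts Q \<inter> X \<subseteq> Z \<or> verts Q \<inter> Z = {})"
    using assms unfolding cluster_edges_def by simp
  then show ?thesis using that by (elim exE conjE) simp
qed

text \<open>The cluster \<open>Y\<close> of one vertex is split off and \<open>X - Y\<close> is
  treated by induction. In \<open>G\<close> the vertices of \<open>Y\<close> are within distance
  (|Y| - 1) r / 2 of each other, so by \<open>geodesic_cycle_near\<close> those on \<open>C\<close>
  are joined within \<open>C\<close> at twice this cost.\<close>

lemma ex_cluster_edges:
  assumes "finite X" "X \<subseteq> verts G"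
  shows "\<exists>A. cluster_edges X A"
  using assms
proof (induction X rule: finite_psubset_induct)
  case (psubset X)
  show ?case
  proof (cases "X = {}")
    case True then show ?thesis by (intro exI[of _ "{}"]) (simp add: cluster_edges_def)
  next
    case False
    then obtain x where "x \<in> X" by blast
    then obtain Y E where Y: "x \<in> Y" "Y \<subseteq> X" and E: "E \<subseteq> edges G"
      "sum l E \<le> real (card Y - 1) * (r / 2)" "\<And>y. y \<in> Y \<Longrightarrow> (x, y) \<in> (adj E)\<^sup>*"
      and Q: "\<And>Q. Q \<in> D \<Longrightarrow> verts Q \<inter> Y \<noteq> {} \<Longrightarrow> verts Q \<inter> X \<subseteq> Y"
      using cluster[OF psubset.hyps psubset.prems] by metis
    have "\<exists>A\<subseteq>edges C. sum l A \<le> real (card Y - 1) * r \<and>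
       (\<forall>S. (\<forall>e\<in>A. \<not> crosses e S) \<longrightarrow> Y \<inter> verts C \<subseteq> S \<or> Y \<inter> verts C \<inter> S = {})"
    proof (cases "Y \<inter> verts C = {}")
      case True then show ?thesis using r by (intro exI[of _ "{}"]) auto
    next
      case False
      then obtain a where a: "a \<in> Y" "a \<in> verts C" by blast
      have "0 \<le> real (card Y - 1) * (r / 2)" using r by simp
      then obtain A where A: "A \<subseteq> edges C" "sum l A \<le> 2 * (real (card Y - 1) * (r / 2))"
        and conn: "\<And>y. y \<in> verts C \<Longrightarrow> gdist G l a y \<le> ereal (real (card Y - 1) * (r / 2)) \<Longrightarrow>
          (a, y) \<in> (adj A)\<^sup>*"
        using geodesic_cycle_near[OF G C a(2)] by metis
      have ay: "(a, y) \<in> (adj A)\<^sup>*" if "y \<in> Y" "y \<in> verts C" for y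
      proof (rule conn[OF that(2)])
        have "(a, y) \<in> (adj E)\<^sup>*"
          using E(3)[OF a(1)] E(3)[OF that(1)] rtrancl_adj_sym rtrancl_trans by metis
        then have "gdist G l a y \<le> ereal (sum l E)"
          using gdist_le[OF G E(1)] a C_sub by blast
        then show "gdist G l a y \<le> ereal (real (card Y - 1) * (r / 2))"
          using E(2) by (meson ereal_less_eq(3) order_trans)
      qed
      have "Y \<inter> verts C \<subseteq> S \<or> Y \<inter> verts C \<inter> S = {}" if "\<forall>e\<in>A. \<not> crosses e S" for S
      proof (cases "a \<in> S")
        case True
        then show ?thesis using that rtrancl_adj_crosses[OF ay] by blast
      next
        case False
        then show ?thesis using that rtrancl_adj_crosses[OF rtrancl_adj_sym[OF ay]] by blast
      qed
      then show ?thesis using A by auto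
    qed
    then obtain A where A: "A \<subseteq> edges C" "sum l A \<le> real (card Y - 1) * r"
      and AS: "\<And>S. \<forall>e\<in>A. \<not> crosses e S \<Longrightarrow> Y \<inter> verts C \<subseteq> S \<or> Y \<inter> verts C \<inter> S = {}" by blast
    have "X - Y \<subset> X" "X - Y \<subseteq> verts G" using Y psubset.prems by auto
    from psubset.IH[OF this] obtain B where BX: "cluster_edges (X - Y) B" by blast
    then have B: "B \<subseteq> edges C" "sum l B \<le> real (card (X - Y) - 1) * r"
      by (simp_all add: cluster_edges_def)
    have fY: "finite Y" "card Y \<noteq> 0" "card Y \<le> card X"
      using Y psubset.hyps finite_subset[of Y X] by (auto intro: card_mono)
    \<comment> \<open>Truncated subtraction makes this an equality for \<open>X = Y\<close>;
      otherwise 1 is gained.\<close>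
    have "card Y - 1 + (card (X - Y) - 1) \<le> card X - 1"
      using fY Y card_Diff_subset[OF fY(1) Y(2)] by simp
    then have "real (card Y - 1) + real (card (X - Y) - 1) \<le> real (card X - 1)" by linarith
    then have "real (card Y - 1) * r + real (card (X - Y) - 1) * r \<le> real (card X - 1) * r"
      using r by (metis distrib_right mult_right_mono)
    then have "sum l (A \<union> B) \<le> real (card X - 1) * r"
      using sum_l_Un[OF subset_trans[OF A(1) C_sub(1)] subset_trans[OF B(1) C_sub(1)]] A(2) B(2)
      by linarith
    moreover have "\<exists>Z\<subseteq>X. Z \<inter> verts C = X \<inter> S \<inter> verts C \<and>
       (\<forall>Q\<in>D. verts Q \<inter> X \<subseteq> Z \<or> verts Q \<inter> Z = {})" if S: "\<forall>e\<in>A \<union> B. \<not> crosses e S" for S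
    proof -
      have SA: "\<forall>e\<in>A. \<not> crosses e S" and SB: "\<forall>e\<in>B. \<not> crosses e S" using S by auto
      obtain Z where Z: "Z \<subseteq> X - Y" "Z \<inter> verts C = (X - Y) \<inter> S \<inter> verts C"
        and ZQ: "\<And>Q. Q \<in> D \<Longrightarrow> verts Q \<inter> (X - Y) \<subseteq> Z \<or> verts Q \<inter> Z = {}"
        using cluster_edgesD[OF BX SB] by metis
      \<comment> \<open>\<open>S\<close> contains all or none of the vertices of \<open>Y\<close> on
        \<open>C\<close>, so the cluster \<open>Y\<close> is added to \<open>Z\<close> as a whole or
        left out.\<close>
      define W where "W = (if Y \<inter> verts C \<subseteq> S then Y else {})"
      have WC: "W \<inter> verts C = Y \<inter> S \<inter> verts C" using AS[OF SA] by (auto simp: W_def)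
      have W: "W = Y \<or> W = {}" by (simp add: W_def)
      \<comment> \<open>A cycle meeting \<open>Y\<close> has all its \<open>X\<close>-vertices in
        \<open>Y\<close> and hence misses \<open>Z\<close>; any other cycle is covered by the
        induction hypothesis.\<close>
      have "verts Q \<inter> X \<subseteq> Z \<union> W \<or> verts Q \<inter> (Z \<union> W) = {}" if "Q \<in> D" for Q
        using Q[OF that] ZQ[OF that] W Z(1) by (cases "verts Q \<inter> Y = {}") blast+
      moreover have "(Z \<union> W) \<inter> verts C = X \<inter> S \<inter> verts C" using Z WC Y by blast
      moreover have "Z \<union> W \<subseteq> X" using Z W Y by blast
      ultimately show ?thesis by blast
    qed
    ultimately have "cluster_edges X (A \<union> B)" using A(1) B(1) by (simp add: cluster_edges_def)
    then show ?thesis by blast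
  qed
qed

text \<open>\<open>K\<close> is a union of components of \<open>G - X\<close>. A cycle in
  \<open>D\<close> that misses \<open>Z\<close> has no edge between \<open>Z\<close> and
  \<open>K\<close>. One that meets \<open>Z\<close> has all its \<open>X\<close>-vertices in
  \<open>Z\<close>, so its edges between \<open>Z\<close> and \<open>K\<close> are exactly those
  leaving \<open>K\<close>, and their number is even. The sum passes this parity on to
  \<open>C\<close>.\<close>

lemma even_F2_cut:
  assumes K: "K \<inter> X = {}" "\<And>g. g \<in> edges G \<Longrightarrow> g \<inter> K \<noteq> {} \<Longrightarrow> g \<subseteq> K \<union> X" "K \<subseteq> verts G"
    and Z: "Z \<subseteq> X" "\<And>Q. Q \<in> D \<Longrightarrow> verts Q \<inter> X \<subseteq> Z \<or> verts Q \<inter> Z = {}"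
  shows "even (card {g\<in>edges C. g \<inter> Z \<noteq> {} \<and> g \<inter> K \<noteq> {}})"
proof -
  define F where "F = {g\<in>edges G. g \<inter> Z \<noteq> {} \<and> g \<inter> K \<noteq> {}}"
  have finK: "finite K" using K(3) G(1) finite_subset by (auto simp: fin_simple_graph_def)
  have "even (card (edges Q \<inter> F))" if Q: "Q \<in> D" for Q
  proof (cases "verts Q \<inter> Z = {}")
    case True
    then have "edges Q \<inter> F = {}" using is_cycle_simple(2) D[OF Q] by (fastforce simp: F_def)
    then show ?thesis by (metis card.empty even_zero)
  next
    case False
    then have QX: "verts Q \<inter> X \<subseteq> Z" using Z(2)[OF Q] by blast
    have QG: "is_cycle Q" "edges Q \<subseteq> edges G" using D[OF Q] by (simp_all add: subgraph_def)
    have "edges Q \<inter> F = {g\<in>edges Q. crosses g K}"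
    proof -
      have "g \<in> F \<longleftrightarrow> crosses g K" if g: "g \<in> edges Q" for g
        using K(1) K(2)[of g] Z(1) QX g QG is_cycle_simple(2)[OF QG(1) g]
        unfolding F_def crosses_def by blast
      then show ?thesis by blast
    qed
    moreover have "even (\<Sum>x\<in>K. card {g\<in>edges Q. x \<in> g})"
      using even_degree[OF QG(1)] by (intro dvd_sum) blast
    ultimately show ?thesis
      using even_degree_sum_iff[of "edges Q" K] is_cycle_simple[OF QG(1)] finK by simp
  qed
  then have "even (card (edges C \<inter> F))"
    using even_inter_F2_sum[OF finite_D _ _ sum] finite_edges[OF G(1)] by (simp add: F_def)
  moreover have "edges C \<inter> F = {g\<in>edges C. g \<inter> Z \<noteq> {} \<and> g \<inter> K \<noteq> {}}" using C_sub by (auto simp: F_def)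
  ultimately show ?thesis by simp
qed

text \<open>Let \<open>S\<close> be the arc of \<open>C\<close> between \<open>e\<close> and \<open>f\<close>, and \<open>M\<close> the edges of \<open>C\<close> that meet \<open>K\<close>. Only
  \<open>e\<close> in \<open>M\<close> crosses \<open>S\<close>, so the \<open>M\<close>-degrees on \<open>S\<close> have odd sum. But they are even off \<open>X\<close>, and on
  \<open>S \<inter> X\<close> they sum to the number of edges of \<open>C\<close> between \<open>K\<close> and a union \<open>Z\<close> of clusters, which is
  even since it is even for every cycle in \<open>D\<close>.\<close>

lemma far_edges_aux:
  assumes X: "X \<subseteq> verts G"
    and A: "cluster_edges X A"
    and K: "K \<inter> X = {}" "\<And>g. g \<in> edges G \<Longrightarrow> g \<inter> K \<noteq> {} \<Longrightarrow> g \<subseteq> K \<union> X" "K \<subseteq> verts G"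
    and e: "e \<in> edges C - A" "e \<inter> K \<noteq> {}" and f: "f \<in> edges C - A" "f \<inter> K = {}"
  shows False
proof -
  have ne: "e \<noteq> f" using e f by blast
  obtain S where S: "S \<subseteq> verts C" "{g\<in>edges C. crosses g S} = {e, f}"
    by (rule cycle_separating_arc[OF C(1) DiffD1[OF e(1)] DiffD1[OF f(1)] ne])
  have cross: "crosses g S \<longleftrightarrow> g \<in> {e, f}" if "g \<in> edges C" for g
    unfolding S(2)[symmetric] using that by simp
  moreover have "A \<subseteq> edges C" using A by (simp add: cluster_edges_def)
  ultimately have "\<forall>g\<in>A. \<not> crosses g S" using e(1) f(1) by blast
  then obtain Z where Z: "Z \<subseteq> X" "Z \<inter> verts C = X \<inter> S \<inter> verts C"
    and ZQ: "\<And>Q. Q \<in> D \<Longrightarrow> verts Q \<inter> X \<subseteq> Z \<or> verts Q \<inter> Z = {}" using cluster_edgesD[OF A] by metis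
  define M where "M = {g\<in>edges C. g \<inter> K \<noteq> {}}"
  have fin: "finite M" "finite S" "finite Z"
    using is_cycle_simple(1)[OF C(1)] S(1) C_sub(2) G(1) X Z(1) finite_subset[of _ "verts G"]
    by (simp_all add: M_def fin_simple_graph_def)
  have M2: "card g = 2 \<and> g \<subseteq> verts C" if "g \<in> M" for g
    using that is_cycle_simple(2)[OF C(1)] by (simp add: M_def)
  define d where "d x = card {g\<in>M. x \<in> g}" for x
  have "{g\<in>M. crosses g S} = {e}" using cross e f by (auto simp: M_def)
  then have "odd (sum d S)"
    using even_degree_sum_iff[of M S] M2 fin unfolding d_def by simp
  moreover have "even (\<Sum>x\<in>S - X. d x)"
  proof (intro dvd_sum)
    fix x assume x: "x \<in> S - X"
    show "even (d x)"
    proof (cases "x \<in> K")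
      case True
      then have "{g\<in>M. x \<in> g} = {g\<in>edges C. x \<in> g}" by (auto simp: M_def)
      then show ?thesis using even_degree[OF C(1)] by (simp add: d_def)
    next
      case False
      \<comment> \<open>Here \<open>x\<close> lies neither in \<open>K\<close> nor in
        \<open>X\<close>, whereas edges meeting \<open>K\<close> stay within the union of the
        two.\<close>
      then have "{g\<in>M. x \<in> g} = {}" using K(2) C_sub x by (fastforce simp: M_def)
      then show ?thesis by (simp add: d_def del: Collect_empty_eq)
    qed
  qed
  moreover have "sum d S = (\<Sum>x\<in>S - X. d x) + (\<Sum>x\<in>S \<inter> X. d x)"
    using fin by (metis Int_Diff_Un Int_Diff_disjoint add.commute finite_Diff finite_Int sum.union_disjoint)
  moreover have "(\<Sum>x\<in>S \<inter> X. d x) = sum d Z"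
  proof -
    have "d x = 0" if "x \<notin> verts C" for x
    proof -
      have "{g\<in>M. x \<in> g} = {}" using M2 that by blast
      then show ?thesis by (simp add: d_def del: Collect_empty_eq)
    qed
    \<comment> \<open>\<open>Z\<close> agrees with \<open>S \<inter> X\<close> on \<open>C\<close>;
      its vertices off \<open>C\<close> have degree 0.\<close>
    moreover have "S \<inter> X \<subseteq> Z" "\<forall>x\<in>Z - S \<inter> X. x \<notin> verts C" using Z S(1) by blast+
    ultimately show ?thesis using fin by (intro sum.mono_neutral_left) auto
  qed
  moreover have "even (sum d Z)"
  proof -
    have "{g\<in>M. crosses g Z} = {g\<in>edges C. g \<inter> Z \<noteq> {} \<and> g \<inter> K \<noteq> {}}"
      using Z(1) K(1) by (auto simp: M_def crosses_def)
    then show ?thesis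
      using even_degree_sum_iff[of M Z] M2 fin even_F2_cut[OF K Z(1) ZQ] unfolding d_def by simp
  qed
  ultimately show False by simp
qed

text \<open>\<open>U\<close> is \<open>edges C - A\<close>, where \<open>A\<close> is shorter than
  \<open>r * real k\<close> and hence than half of \<open>C\<close>; it is chosen before
  \<open>K\<close>. At most \<open>k\<close> edges of \<open>C\<close> lie inside \<open>X\<close>,
  each of length at most \<open>r\<close>; together they make up at most half of \<open>C\<close>,
  so \<open>U\<close> has an edge not inside \<open>X\<close>.\<close>

lemma far_edges:
  assumes X: "X \<subseteq> verts G" "card X \<le> k" and len: "glength l C \<ge> 2 * r * real k" and r0: "0 < r" "1 \<le> k"
  obtains U where "U \<subseteq> edges C" "glength l C / 2 < sum l U"
    "\<forall>K\<subseteq>verts G. K \<inter> X = {} \<longrightarrow> (\<forall>g\<in>edges G. g \<inter> K \<noteq> {} \<longrightarrow> g \<subseteq> K \<union> X) \<longrightarrow>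
       (\<exists>e\<in>U. e \<inter> K \<noteq> {}) \<longrightarrow> (\<forall>f\<in>U. f \<inter> K \<noteq> {})"
    "\<exists>e\<in>U. \<not> e \<subseteq> X"
proof -
  have finX: "finite X" using X G(1) finite_subset by (auto simp: fin_simple_graph_def)
  obtain A where AX: "cluster_edges X A" using ex_cluster_edges[OF finX X(1)] by blast
  then have A: "A \<subseteq> edges C" "sum l A \<le> real (card X - 1) * r" by (simp_all add: cluster_edges_def)
  have finC: "finite (edges C)" by (rule is_cycle_simple(1)[OF C(1)])
  \<comment> \<open>For empty \<open>X\<close> the truncated \<open>card X - 1\<close> is 0, and the
    bound rests on \<open>1 \<le> k\<close>.\<close>
  have "real (card X - 1) * r \<le> (real k - 1) * r" using X r0 by (intro mult_right_mono) auto
  also have "\<dots> < real k * r" using r0 by simp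
  finally have "sum l A < real k * r" using A(2) by simp
  moreover have "2 * r * real k = 2 * (real k * r)" by simp
  ultimately have "sum l A < glength l C / 2" using len by linarith
  moreover have "sum l (edges C - A) = glength l C - sum l A"
    unfolding glength_def by (rule sum_diff[OF finC A(1)])
  ultimately have big: "glength l C / 2 < sum l (edges C - A)" by simp
  show ?thesis
  proof
    show "\<forall>K\<subseteq>verts G. K \<inter> X = {} \<longrightarrow> (\<forall>g\<in>edges G. g \<inter> K \<noteq> {} \<longrightarrow> g \<subseteq> K \<union> X) \<longrightarrow>
       (\<exists>e\<in>edges C - A. e \<inter> K \<noteq> {}) \<longrightarrow> (\<forall>f\<in>edges C - A. f \<inter> K \<noteq> {})"
    proof (intro allI impI ballI notI, elim bexE)
      fix K e f
      assume "K \<subseteq> verts G" "K \<inter> X = {}" "\<forall>g\<in>edges G. g \<inter> K \<noteq> {} \<longrightarrow> g \<subseteq> K \<union> X"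
        and ef: "f \<in> edges C - A" "f \<inter> K = {}" "e \<in> edges C - A" "e \<inter> K \<noteq> {}"
      then show False by (intro far_edges_aux[OF X(1) AX _ _ _ ef(3,4,1,2)]) auto
    qed
    show "\<exists>e\<in>edges C - A. \<not> e \<subseteq> X"
    proof (rule ccontr)
      assume "\<not> ?thesis"
      then have sub: "edges C - A \<subseteq> {g\<in>edges C. g \<subseteq> X}" by blast
      obtain n v where "cyclic_enum C n v" using is_cycle_enum C by blast
      then interpret cycle_enum C n v by unfold_locales
      \<comment> \<open>Each edge of \<open>C\<close> inside \<open>X\<close> is charged to its
        first vertex in the cyclic order.\<close>
      have "{g\<in>edges C. g \<subseteq> X} \<subseteq> edge ` {i\<in>{..<n}. v i \<in> X}" unfolding edges_image by auto
      then have "card {g\<in>edges C. g \<subseteq> X} \<le> card (edge ` {i\<in>{..<n}. v i \<in> X})"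
        by (intro card_mono) auto
      also have "\<dots> \<le> card {i\<in>{..<n}. v i \<in> X}" by (rule card_image_le) simp
      also have "\<dots> \<le> card X"
        using finX by (intro card_inj_on_le[of v]) (auto intro!: inj_onI simp: v_eq)
      finally have c: "card {g\<in>edges C. g \<subseteq> X} \<le> k" using X by simp
      have "sum l (edges C - A) \<le> sum l {g\<in>edges C. g \<subseteq> X}"
        using sub finC l_nonneg C_sub by (intro sum_mono2) auto
      also have "\<dots> \<le> real (card {g\<in>edges C. g \<subseteq> X}) * r" using edge_le by (intro sum_bounded_above) auto
      also have "\<dots> \<le> real k * r" using c r0 by (intro mult_right_mono) auto
      finally show False using big len by (simp add: mult.commute)
    qed
  qed (use big in auto)
qed

end

section \<open>Tree-decompositions\<close>

text \<open>For distinct nodes \<open>s\<close> and \<open>t\<close> this is the component of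
  \<open>T - t\<close> containing \<open>s\<close>; dropping the edges at \<open>t\<close> stands
  for deleting \<open>t\<close>.\<close>

definition branch :: "'t graph \<Rightarrow> 't \<Rightarrow> 't \<Rightarrow> 't set" where
  "branch T t s = {u \<in> verts T. (s, u) \<in> (adj {e \<in> edges T. t \<notin> e})\<^sup>*}"

text \<open>In a tree-decomposition this is a union of components of \<open>G - B t\<close>.\<close>

definition side :: "'t graph \<Rightarrow> ('t \<Rightarrow> 'v set) \<Rightarrow> 't \<Rightarrow> 't \<Rightarrow> 'v set" where
  "side T B t s = (\<Union>u\<in>branch T t s. B u) - B t"

lemma tree_path:
  assumes "is_tree T" "s \<in> verts T" "t \<in> verts T"
  obtains P where "path_between s t P" "subgraph P T"
  using assms unfolding is_tree_def connected_graph_def by blast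

lemma tree_decomposition_edge:
  assumes TD: "tree_decomposition G T B" and e: "e \<in> edges G"
  obtains w where "w \<in> verts T" "e \<subseteq> B w"
proof -
  have "\<forall>e\<in>edges G. \<exists>w\<in>verts T. e \<subseteq> B w"
    using TD unfolding tree_decomposition_def by (elim conjE)
  from bspec[OF this e] show ?thesis by (rule bexE) (rule that)
qed

lemma tree_decomposition_bag_subset: "tree_decomposition G T B \<Longrightarrow> t \<in> verts T \<Longrightarrow> B t \<subseteq> verts G"
  by (auto simp: tree_decomposition_def)

text \<open>Every bag on the path of \<open>T\<close> from \<open>u\<close> to \<open>w\<close>
  contains \<open>a\<close>, so this path avoids \<open>t\<close>.\<close>

lemma branch_closed:
  assumes TD: "tree_decomposition G T B" and u: "u \<in> branch T t s" and w: "w \<in> verts T"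
    and a: "a \<in> B u" "a \<in> B w" "a \<notin> B t"
  shows "w \<in> branch T t s"
proof -
  have "is_tree T" "u \<in> verts T" using TD u by (simp_all add: tree_decomposition_def branch_def)
  then obtain P where P: "path_between u w P" "subgraph P T" using w by (rule tree_path)
  then have "\<forall>x\<in>verts P. a \<in> B x" using TD a unfolding tree_decomposition_def by blast
  then have "t \<notin> verts P" using a by blast
  then have "edges P \<subseteq> {e \<in> edges T. t \<notin> e}"
    using P(2) by (auto simp: subgraph_def fin_simple_graph_def)
  moreover have "w \<in> verts P" using P(1) by (auto simp: path_between_def path_graph_def)
  ultimately have "(u, w) \<in> (adj {e \<in> edges T. t \<notin> e})\<^sup>*"
    using path_between_rtrancl_adj[OF P(1)] rtrancl_adj_mono by metis
  then show ?thesis using u w by (auto simp: branch_def)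
qed

text \<open>The edge has an end outside \<open>B t\<close> that lies both in a bag of the branch and
  in \<open>B w\<close>.\<close>

lemma side_closed:
  assumes TD: "tree_decomposition G T B" and g: "g \<in> edges G" "g \<inter> side T B t s \<noteq> {}"
    and w: "w \<in> verts T" "g \<subseteq> B w"
  shows "w \<in> branch T t s"
  using branch_closed[OF TD _ w(1)] g w(2) unfolding side_def by blast

lemma side_separated:
  assumes TD: "tree_decomposition G T B" and g: "g \<in> edges G" "g \<inter> side T B t s \<noteq> {}"
  shows "g \<subseteq> side T B t s \<union> B t"
proof -
  obtain w where "w \<in> verts T" "g \<subseteq> B w" by (rule tree_decomposition_edge[OF TD g(1)])
  then show ?thesis using side_closed[OF TD g] by (auto simp: side_def)
qed

section \<open>Trees: opposite branches and orientations\<close>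

lemma tree_not_closed_path:
  assumes T: "is_tree T" and xs: "3 \<le> length xs" "distinct xs" "edges (path_graph xs) \<subseteq> edges T"
  shows "{last xs, hd xs} \<notin> edges T"
proof
  assume e: "{last xs, hd xs} \<in> edges T"
  define Q where "Q = Graph (set xs) (insert {last xs, hd xs} (edges (path_graph xs)))"
  have fT: "fin_simple_graph T" using T by (simp add: is_tree_def)
  have Q: "is_cycle Q" unfolding is_cycle_def Q_def using xs by blast
  have "hd xs \<in> verts T" using fT e by (auto simp: fin_simple_graph_def)
  then have "set xs \<subseteq> verts T" using verts_path_graph_subset[OF fT _ _ xs(3)] xs(1) by fastforce
  moreover have "edges Q \<subseteq> edges T" using xs e by (auto simp: Q_def)
  moreover have "finite (verts Q)" by (simp add: Q_def)
  ultimately have "subgraph Q T"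
    using is_cycle_simple(2)[OF Q] unfolding subgraph_def fin_simple_graph_def by (simp add: Q_def)
  then show False using T Q unfolding is_tree_def by blast
qed

text \<open>A common node would connect \<open>s\<close> to \<open>t\<close> without the edge
  between them. A path avoiding this edge has at least three vertices and is closed by it to a
  cycle.\<close>

lemma tree_opposite_branches:
  assumes T: "is_tree T" and st: "{s, t} \<in> edges T"
  shows "branch T t s \<inter> branch T s t = {}"
proof (rule ccontr)
  assume "\<not> ?thesis"
  then obtain w where w: "(s, w) \<in> (adj {e \<in> edges T. t \<notin> e})\<^sup>*" "(t, w) \<in> (adj {e \<in> edges T. s \<notin> e})\<^sup>*"
    by (auto simp: branch_def)
  define E where "E = edges T - {{s, t}}"
  have "{e \<in> edges T. t \<notin> e} \<subseteq> E" "{e \<in> edges T. s \<notin> e} \<subseteq> E" by (auto simp: E_def)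
  then have "(s, t) \<in> (adj E)\<^sup>*" using w rtrancl_adj_mono rtrancl_adj_sym rtrancl_trans by metis
  then obtain xs where xs: "xs \<noteq> []" "distinct xs" "hd xs = s" "last xs = t" "edges (path_graph xs) \<subseteq> E"
    using rtrancl_adj_path by metis
  have fT: "fin_simple_graph T" using T by (simp add: is_tree_def)
  have "card {s, t} = 2" using fT st by (auto simp: fin_simple_graph_def)
  then have "s \<noteq> t" by auto
  have len: "3 \<le> length xs"
  proof (rule ccontr)
    assume "\<not> ?thesis"
    moreover have "length xs \<noteq> 0" using xs(1) by simp
    ultimately have "length xs = 1 \<or> length xs = 2" by linarith
    then have "xs = [s, t]" using xs \<open>s \<noteq> t\<close> by (auto simp: length_Suc_conv numeral_2_eq_2)
    then show False using xs(5) unfolding edges_path_graph_subset E_def by simp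
  qed
  have "edges (path_graph xs) \<subseteq> edges T" using xs(5) by (auto simp: E_def)
  then show False
    using tree_not_closed_path[OF T len xs(2)] xs(3,4) st by (simp add: insert_commute)
qed

text \<open>Iterating \<open>f\<close> runs into a periodic orbit, which is a cycle unless its period is 2.\<close>

lemma tree_orientation:
  assumes T: "is_tree T" and f: "\<And>t. t \<in> verts T \<Longrightarrow> {t, f t} \<in> edges T"
  obtains t where "t \<in> verts T" "f (f t) = t"
proof -
  have fT: "finite (verts T)" "\<And>e. e \<in> edges T \<Longrightarrow> e \<subseteq> verts T \<and> card e = 2"
    using T by (auto simp: is_tree_def fin_simple_graph_def)
  obtain t0 where t0: "t0 \<in> verts T" using T by (auto simp: is_tree_def connected_graph_def)
  have fV: "f t \<in> verts T" "f t \<noteq> t" if "t \<in> verts T" for t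
    using fT(2)[OF f[OF that]] by auto
  have iter: "(f ^^ i) t \<in> verts T" if "t \<in> verts T" for i t
    using that fV by (induction i) auto
  have "range (\<lambda>i. (f ^^ i) t0) \<subseteq> verts T" using iter[OF t0] by blast
  then have "finite (range (\<lambda>i. (f ^^ i) t0))" using fT(1) by (rule finite_subset)
  then have "\<not> inj (\<lambda>i. (f ^^ i) t0)" using finite_imageD infinite_UNIV_nat by blast
  then obtain i j where ij: "i < j" "(f ^^ i) t0 = (f ^^ j) t0"
    using linorder_injI[of "\<lambda>i. (f ^^ i) t0"] by blast
  define t where "t = (f ^^ i) t0"
  have t: "t \<in> verts T" using iter t0 by (simp add: t_def)
  have "(f ^^ (j - i)) t = (f ^^ (j - i + i)) t0" by (simp add: t_def funpow_add)
  then have ex: "0 < j - i \<and> (f ^^ (j - i)) t = t" using ij by (simp add: t_def)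
  \<comment> \<open>Minimality of the period makes the first \<open>p\<close> iterates
    distinct.\<close>
  define p where "p = (LEAST p. 0 < p \<and> (f ^^ p) t = t)"
  have p: "0 < p" "(f ^^ p) t = t" using LeastI[of "\<lambda>p. 0 < p \<and> (f ^^ p) t = t", OF ex] by (simp_all add: p_def)
  have min: "(f ^^ q) t \<noteq> t" if "0 < q" "q < p" for q
    using that not_less_Least[of q "\<lambda>p. 0 < p \<and> (f ^^ p) t = t"] by (auto simp: p_def)
  have p1: "p \<noteq> 1" using p fV[OF t] by auto
  show ?thesis
  proof (cases "p = 2")
    case True
    then show ?thesis using p that[OF t] by (simp add: numeral_2_eq_2)
  next
    case False
    then have p3: "3 \<le> p" using p p1 by linarith
    define xs where "xs = map (\<lambda>i. (f ^^ i) t) [0..<p]"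
    \<comment> \<open>Another \<open>p - b\<close> steps turn the right-hand side into
      \<open>t\<close> and so give the smaller period \<open>p - b + a\<close>.\<close>
    have neq: False if "a < b" "b < p" "(f ^^ a) t = (f ^^ b) t" for a b
    proof -
      have "(f ^^ (p - b + a)) t = (f ^^ (p - b + b)) t" using that by (simp only: funpow_add o_apply)
      moreover have "p - b + b = p" using that by simp
      ultimately have "(f ^^ (p - b + a)) t = t" using p by simp
      moreover have "(f ^^ (p - b + a)) t \<noteq> t" by (rule min) (use that in auto)
      ultimately show False by contradiction
    qed
    have "inj_on (\<lambda>i. (f ^^ i) t) {0..<p}"
    proof (rule inj_onI)
      fix a b assume "a \<in> {0..<p}" "b \<in> {0..<p}" "(f ^^ a) t = (f ^^ b) t"
      then show "a = b" using neq[of a b] neq[of b a] by (cases a b rule: linorder_cases) auto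
    qed
    then have dist: "distinct xs" by (simp add: xs_def distinct_map)
    have len: "length xs = p" by (simp add: xs_def)
    have step: "{(f ^^ i) t, (f ^^ Suc i) t} \<in> edges T" for i using f[OF iter[OF t]] by simp
    have "edges (path_graph xs) \<subseteq> edges T"
      using step by (auto simp: path_graph_def xs_def simp del: upt_Suc)
    moreover have "xs \<noteq> []" using len p by auto
    \<comment> \<open>As \<open>(f ^^ p) t = t\<close>, the closing edge is just one more step of
      \<open>f\<close>.\<close>
    then have "last xs = (f ^^ (p - 1)) t" "hd xs = (f ^^ Suc (p - 1)) t"
      using p by (simp_all add: last_conv_nth hd_conv_nth len) (simp_all add: xs_def)
    then have "{last xs, hd xs} \<in> edges T" using step by metis
    ultimately show ?thesis using tree_not_closed_path[OF T _ dist] p3 len by simp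
  qed
qed

text \<open>\<open>s\<close> is the second node on the path from \<open>t\<close> to
  \<open>w\<close>; by distinctness the rest of the path avoids \<open>t\<close>.\<close>

lemma tree_neighbour_branch:
  assumes T: "is_tree T" and t: "t \<in> verts T" "w \<in> verts T" "w \<noteq> t"
  obtains s where "{t, s} \<in> edges T" "w \<in> branch T t s"
proof -
  obtain P where P: "path_between t w P" "subgraph P T" by (rule tree_path[OF T t(1,2)])
  then obtain xs where xs: "xs \<noteq> []" "distinct xs" "hd xs = t" "last xs = w" "P = path_graph xs"
    by (auto simp: path_between_def)
  have succ: "successively (\<lambda>u w. {u, w} \<in> edges T) xs"
    using P(2) xs(5) by (auto simp: subgraph_def simp flip: edges_path_graph_subset)
  obtain ys where ys: "xs = t # ys" using xs(1,3) by (cases xs) auto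
  then have ne: "ys \<noteq> []" using xs t by auto
  have "successively (\<lambda>u w. {u, w} \<in> {e \<in> edges T. t \<notin> e}) ys"
    by (rule successively_mono[of "\<lambda>u w. {u, w} \<in> edges T"])
      (use succ xs(2) ys in \<open>auto simp: successively_Cons\<close>)
  moreover have "w \<in> set ys" using xs(4) ys ne last_in_set[OF ne] by simp
  ultimately have "(hd ys, w) \<in> (adj {e \<in> edges T. t \<notin> e})\<^sup>*"
    using ne by (intro successively_rtrancl_adj)
  moreover have "{t, hd ys} \<in> edges T" using succ ys ne by (simp add: successively_Cons)
  ultimately show ?thesis using that t by (simp add: branch_def)
qed

lemma (in geodesic_cycle_sum) decomposition_width_ge:
  assumes TD: "tree_decomposition G T B" and len: "glength l C \<ge> 2 * r * real k" and r0: "0 < r" "1 \<le> k"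
  shows "int k \<le> decomposition_width T B"
proof (rule ccontr)
  assume small: "\<not> ?thesis"
  have T: "is_tree T" using TD by (simp add: tree_decomposition_def)
  then have finT: "finite (verts T)" by (simp add: is_tree_def fin_simple_graph_def)
  have card: "card (B t) \<le> k" if "t \<in> verts T" for t
  proof -
    have "card (B t) \<le> Max ((\<lambda>t. card (B t)) ` verts T)" using that finT by (intro Max_ge) auto
    then show ?thesis using small by (simp add: decomposition_width_def)
  qed
  \<comment> \<open>Each node \<open>t\<close> points to a neighbour \<open>s\<close> such that
    every edge of \<open>U\<close> meets the side of \<open>s\<close>.\<close>
  have "\<exists>s U. {t, s} \<in> edges T \<and> U \<subseteq> edges C \<and> glength l C / 2 < sum l U \<and> (\<forall>g\<in>U. g \<inter> side T B t s \<noteq> {})"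
    if t: "t \<in> verts T" for t
  proof -
    obtain U where U: "U \<subseteq> edges C" "glength l C / 2 < sum l U"
      and all: "\<forall>K\<subseteq>verts G. K \<inter> B t = {} \<longrightarrow> (\<forall>g\<in>edges G. g \<inter> K \<noteq> {} \<longrightarrow> g \<subseteq> K \<union> B t) \<longrightarrow>
       (\<exists>e\<in>U. e \<inter> K \<noteq> {}) \<longrightarrow> (\<forall>f\<in>U. f \<inter> K \<noteq> {})"
      and ex: "\<exists>e\<in>U. \<not> e \<subseteq> B t"
      by (rule far_edges[OF tree_decomposition_bag_subset[OF TD t] card[OF t] len r0])
    obtain e where e: "e \<in> U" "\<not> e \<subseteq> B t" using ex by blast
    then have "e \<in> edges G" using U C_sub by blast
    then obtain w where w: "w \<in> verts T" "e \<subseteq> B w" by (rule tree_decomposition_edge[OF TD])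
    then have "w \<noteq> t" using e by blast
    then obtain s where s: "{t, s} \<in> edges T" "w \<in> branch T t s"
      using tree_neighbour_branch[OF T t w(1)] by metis
    have "e \<inter> side T B t s \<noteq> {}" using e(2) w(2) s(2) by (auto simp: side_def)
    moreover have "side T B t s \<subseteq> verts G"
      using tree_decomposition_bag_subset[OF TD] by (auto simp: side_def branch_def)
    moreover have "side T B t s \<inter> B t = {}" by (auto simp: side_def)
    \<comment> \<open>The side is a union of components of \<open>G - B t\<close>, and the one edge
      \<open>e\<close> meeting it forces all of \<open>U\<close> to meet it.\<close>
    ultimately have "\<forall>g\<in>U. g \<inter> side T B t s \<noteq> {}"
      using all[rule_format, of "side T B t s"] side_separated[OF TD] e(1) by blast
    then show ?thesis using s(1) U by blast
  qed
  then obtain f U where f: "\<And>t. t \<in> verts T \<Longrightarrow> {t, f t} \<in> edges T"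
    and U: "\<And>t. t \<in> verts T \<Longrightarrow> U t \<subseteq> edges C" "\<And>t. t \<in> verts T \<Longrightarrow> glength l C / 2 < sum l (U t)"
    "\<And>t. t \<in> verts T \<Longrightarrow> \<forall>g\<in>U t. g \<inter> side T B t (f t) \<noteq> {}" by metis
  obtain t where t: "t \<in> verts T" "f (f t) = t" using tree_orientation[OF T f] by metis
  define s where "s = f t"
  have s: "s \<in> verts T" using f[OF t(1)] T by (auto simp: s_def is_tree_def fin_simple_graph_def)
  \<comment> \<open>Each of the two sets has more than half of the length of
    \<open>C\<close>.\<close>
  have "U t \<inter> U s \<noteq> {}"
  proof
    assume "U t \<inter> U s = {}"
    moreover have fin: "finite (edges C)" by (rule is_cycle_simple(1)[OF C(1)])
    ultimately have "sum l (U t) + sum l (U s) = sum l (U t \<union> U s)"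
      using U(1)[OF t(1)] U(1)[OF s] by (metis finite_subset sum.union_disjoint)
    also have "\<dots> \<le> glength l C" unfolding glength_def
      using U(1)[OF t(1)] U(1)[OF s] fin C_sub l_nonneg by (intro sum_mono2) auto
    finally show False using U(2)[OF t(1)] U(2)[OF s] by simp
  qed
  then obtain g where g: "g \<in> U t" "g \<in> U s" by blast
  then have gG: "g \<in> edges G" using U(1)[OF s] C_sub by blast
  then obtain w where w: "w \<in> verts T" "g \<subseteq> B w" by (rule tree_decomposition_edge[OF TD])
  \<comment> \<open>Since \<open>g\<close> meets both sides, a node whose bag contains
    \<open>g\<close> lies in both opposite branches.\<close>
  have "w \<in> branch T t s" using side_closed[OF TD gG _ w] U(3)[OF t(1)] g by (simp add: s_def)
  moreover have "w \<in> branch T s t" using side_closed[OF TD gG _ w] U(3)[OF s] g t by (simp add: s_def)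
  ultimately show False
    using tree_opposite_branches[OF T, of s t] f[OF t(1)] by (auto simp: s_def insert_commute)
qed

text \<open>Makes the infimum in \<open>tree_width\<close> range over a nonempty set; a single bag
  holding all vertices suffices.\<close>

lemma ex_tree_decomposition:
  assumes "fin_simple_graph G"
  shows "\<exists>(T :: nat graph) B. tree_decomposition G T B"
proof -
  define T where "T = Graph {0 :: nat} {}"
  have "path_between 0 0 (path_graph [0 :: nat])" unfolding path_between_def
    by (intro exI[of _ "[0]"]) auto
  moreover have "subgraph (path_graph [0]) T"
    by (simp add: T_def path_graph_def subgraph_def fin_simple_graph_def)
  ultimately have "connected_graph T" by (auto simp: connected_graph_def T_def)
  moreover have "\<not> subgraph Q T" if "is_cycle Q" for Q :: "nat graph"
    using that by (auto simp: is_cycle_def subgraph_def T_def)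
  then have "\<nexists>Q. is_cycle Q \<and> subgraph Q T" by blast
  ultimately have "is_tree T" by (simp add: is_tree_def T_def fin_simple_graph_def)
  then have "tree_decomposition G T (\<lambda>_. verts G)"
    using assms by (auto simp: tree_decomposition_def T_def fin_simple_graph_def)
  then show ?thesis by blast
qed

theorem theorem1:
  fixes G C :: "'v graph" and l :: "'v set \<Rightarrow> real" and k :: nat and r :: real
  assumes "k \<ge> 1" and "r > 0"
    and "fin_simple_graph G"
    and "length_function G l"
    and "\<forall>e\<in>edges G. l e \<in> \<rat>"
    and "is_cycle C" and "geodesic G l C"
    and "glength l C \<ge> 2 * r * real k"
    and "\<exists>D. (\<forall>X\<in>D. is_cycle X \<and> subgraph X G \<and> glength l X \<le> r) \<and> is_F2_sum G C D"
  shows "tree_width G \<ge> int k"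
proof -
  obtain D where "\<forall>X\<in>D. is_cycle X \<and> subgraph X G \<and> glength l X \<le> r" "is_F2_sum G C D"
    using assms by blast
  then interpret geodesic_cycle_sum G C l r D
    using assms by unfold_locales auto
  show ?thesis
    unfolding tree_width_def
    using ex_tree_decomposition[OF assms(3)] decomposition_width_ge[OF _ assms(8,2,1)]
    by (intro cInf_greatest) blast+
qed

end
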